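(* Let $F=\mathbb{R}$ or $\mathbb{C}$ and let $G=Sp_4(F)$. Then for all $r\in\mathbb{R}$, $$\int_{[N,N]}a(n)^{-\rho}\,\bigl(1+\rho(\log a(n))\bigr)^{r}\,dn<\infty .$$
   Context: Let $L=\begin{pmatrix}0&1\\1&0\end{pmatrix}$, $J=\begin{pmatrix}0&L\\-L&0\end{pmatrix}$, and realize $Sp_4(F)=\{g\in GL(4,F): gJg^{T}=J\}$. $N$ is the group of upper triangular matrices in $G$ with ones on the main diagonal, $\bar N=N^T$, $A$ is the group of diagonal matrices in $G$ with positive real entries, and $K$ is the maximal compact subgroup $G\cap O(4)$ if $F=\mathbb{R}$, $G\cap U(4)$ if $F=\mathbb{C}$. $G=\bar NAK$ is an Iwasawa decomposition; for $g\in G$ write $g=\bar n\,a(g)\,k$ with $\bar n\in \bar N$, $a(g)\in A$, $k\in K$. For $a\in A$, $a^{\rho}=\bigl(\det \mathrm{Ad}(a)|_{\mathrm{Lie}(N)}\bigr)^{1/2}$ (determinant over $\mathbb{R}$) and $\rho(\log a)=\log(a^{\rho})$. $[N,N]$ is the commutator subgroup of $N$, consisting of the matrices $$\begin{pmatrix}1&0&y&z\\0&1&0&y\\0&0&1&0\\0&0&0&1\end{pmatrix},\qquad y,z\in F,$$ and $dn$ is a Haar measure on it (Lebesgue measure in $y,z$). *)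

theory Defs
  imports "HOL-Analysis.Analysis" "HOL-Algebra.Generated_Groups"
begin

text \<open>
  The ground field is a type \<open>'a\<close>, to be instantiated with \<^typ>\<open>real\<close> or \<^typ>\<open>complex\<close>.
  Rows and columns are indexed by the type \<^typ>\<open>4\<close> with elements \<open>1, 2, 3, 4\<close>, in this order;
  the order of the type itself must not be used, since there \<open>4 = 0\<close> is the least element.
\<close>

definition J4 :: "'a::comm_ring_1^4^4" where
  "J4 = vector [vector [ 0,  0, 0, 1],
                vector [ 0,  0, 1, 0],
                vector [ 0, -1, 0, 0],
                vector [-1,  0, 0, 0]]"

definition GL4 :: "('a::field^4^4) monoid" where
  "GL4 = \<lparr>carrier = {g. invertible g}, mult = (**), one = mat 1\<rparr>"

definition Sp4 :: "('a::field^4^4) set" where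
  "Sp4 = {g \<in> carrier GL4. g ** J4 ** transpose g = J4}"

definition N4 :: "('a::field^4^4) set" where
  "N4 = {g \<in> Sp4. (\<forall>i. g$i$i = 1) \<and>
           g$2$1 = 0 \<and> g$3$1 = 0 \<and> g$3$2 = 0 \<and> g$4$1 = 0 \<and> g$4$2 = 0 \<and> g$4$3 = 0}"

definition Nbar4 :: "('a::field^4^4) set" where
  "Nbar4 = transpose ` N4"

definition A4 :: "('a::real_normed_field^4^4) set" where
  "A4 = {g \<in> Sp4. (\<forall>i j. i \<noteq> j \<longrightarrow> g$i$j = 0) \<and> (\<forall>i. \<exists>x::real. x > 0 \<and> g$i$i = of_real x)}"

definition K4_real :: "(real^4^4) set" where
  "K4_real = {g \<in> Sp4. orthogonal_matrix g}"

definition adjoint_matrix :: "complex^'n^'m \<Rightarrow> complex^'m^'n" where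
  "adjoint_matrix g = (\<chi> i j. cnj (g$j$i))"

definition unitary_matrix :: "complex^'n^'n \<Rightarrow> bool" where
  "unitary_matrix g \<longleftrightarrow> adjoint_matrix g ** g = mat 1 \<and> g ** adjoint_matrix g = mat 1"

definition K4_complex :: "(complex^4^4) set" where
  "K4_complex = {g \<in> Sp4. unitary_matrix g}"

text \<open>The \<open>A\<close>-component in the Iwasawa decomposition \<open>G = N\<^sup>- A K\<close>; the compact group is a
  parameter, as it is the only ingredient that depends on whether the field is real or complex.\<close>

definition iwasawa_a :: "('a::real_normed_field^4^4) set \<Rightarrow> 'a^4^4 \<Rightarrow> 'a^4^4" where
  "iwasawa_a K g = (THE a. a \<in> A4 \<and> (\<exists>nbar\<in>Nbar4. \<exists>k\<in>K. g = nbar ** a ** k))"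

text \<open>The Lie algebra of a closed matrix group, as its tangent space at the identity.\<close>

definition lie_algebra :: "('a::real_normed_field^4^4) set \<Rightarrow> ('a^4^4) set" where
  "lie_algebra H = {X. \<exists>\<gamma> :: real \<Rightarrow> 'a^4^4.
     (\<forall>t. \<gamma> t \<in> H) \<and> \<gamma> 0 = mat 1 \<and> (\<gamma> has_vector_derivative X) (at 0)}"

definition Ad :: "'a::real_normed_field^4^4 \<Rightarrow> 'a^4^4 \<Rightarrow> 'a^4^4" where
  "Ad g X = g ** X ** matrix_inv g"

text \<open>The determinant over the reals of a linear endomorphism \<open>f\<close> of a finite-dimensional real
  subspace \<open>V\<close>: the Leibniz formula for the matrix of \<open>f\<close> in some basis of \<open>V\<close> (the value does not
  depend on the basis).\<close>

definition det_on :: "'v::real_vector set \<Rightarrow> ('v \<Rightarrow> 'v) \<Rightarrow> real" where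
  "det_on V f =
     (let B = (SOME B. independent B \<and> span B = V)
      in \<Sum>p | p permutes B. of_int (sign p) * (\<Prod>b\<in>B. representation B (f b) (p b)))"

definition rho_power :: "'a::real_normed_field^4^4 \<Rightarrow> real" where
  "rho_power a = sqrt (det_on (lie_algebra (N4 :: ('a^4^4) set)) (Ad a))"

definition rho_log :: "'a::real_normed_field^4^4 \<Rightarrow> real" where
  "rho_log a = ln (rho_power a)"

definition commN4 :: "('a::field^4^4) set" where
  "commN4 = derived GL4 N4"

definition commN4_elt :: "'a::field \<Rightarrow> 'a \<Rightarrow> 'a^4^4" where
  "commN4_elt y z = vector [vector [1, 0, y, z],
                            vector [0, 1, 0, y],
                            vector [0, 0, 1, 0],
                            vector [0, 0, 0, 1]]"

text \<open>The Haar measure on \<^const>\<open>commN4\<close>: Lebesgue measure in the coordinates \<open>y\<close>, \<open>z\<close> (the group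
  is the image of \<^const>\<open>commN4_elt\<close>), regarded as a Borel measure on the space of matrices that is
  concentrated on this group. For the complex field it is Lebesgue measure on a real
  four-dimensional space.\<close>

definition haar_commN4 :: "('a::{real_normed_field, euclidean_space}^4^4) measure" where
  "haar_commN4 = distr (lborel :: ('a \<times> 'a) measure) borel (\<lambda>(y, z). commN4_elt y z)"

end

theory Submission
  imports Defs "HOL-Real_Asymp.Real_Asymp"
begin

text \<open>
  For \<open>n = n(y, z)\<close> let \<open>d\<close> and \<open>e\<close> be the first two leading principal minors of \<open>n n\<^sup>*\<close>, that is
  \<open>d = 1 + \<bar>y\<bar>\<^sup>2 + \<bar>z\<bar>\<^sup>2\<close> and \<open>e = (1 + \<bar>y\<bar>\<^sup>2)\<^sup>2 + \<bar>z\<bar>\<^sup>2\<close>. Comparing minors in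
  \<open>n n\<^sup>* = l a\<^sup>2 l\<^sup>*\<close>, with \<open>l\<close> lower unitriangular, gives \<open>a\<^sub>1 = \<surd>d\<close>, \<open>a\<^sub>1 a\<^sub>2 = \<surd>e\<close>, and the
  roots \<open>a\<^sub>1 / a\<^sub>2\<close>, \<open>a\<^sub>2\<^sup>2\<close>, \<open>a\<^sub>1 a\<^sub>2\<close>, \<open>a\<^sub>1\<^sup>2\<close> give \<open>a\<^sup>\<rho> = (d e)\<^bsup>m/2\<^esup>\<close>, where \<open>m\<close> is the
  real dimension of the field. The logarithmic factor is absorbed by an arbitrarily small power of
  \<open>a\<^sup>\<rho>\<close>, and since \<open>d e\<close> is at least the \<open>4/3\<close>-th power of \<open>(1 + \<bar>y\<bar>\<^sup>2) (1 + \<bar>z\<bar>\<^sup>2)\<close>, the integrand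
  is dominated by a product of integrable functions \<open>(1 + u\<^sup>2)\<^bsup>-3/5\<^esup>\<close> of the real coordinates \<open>u\<close>.

  The real and the complex case are treated together, over a field with an abstract conjugation.
\<close>

subsection \<open>Determinants of endomorphisms\<close>

text \<open>Conjugation by \<open>\<beta>\<close> matches the permutations of the index type with
  those of the basis and preserves signs. This turns the Leibniz sum in \<open>det_on\<close> into
  the determinant of a square matrix, for which multiplicativity is available.\<close>

lemma det_on_eq_det:
  fixes \<beta> :: "'n::finite \<Rightarrow> 'v::real_vector"
  assumes "inj \<beta>"
  shows "(\<Sum>p | p permutes range \<beta>.
            of_int (sign p) * (\<Prod>b\<in>range \<beta>. representation (range \<beta>) (f b) (p b)))
         = det (\<chi> i j. representation (range \<beta>) (f (\<beta> i)) (\<beta> j) :: real^'n^'n)"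
proof -
  let ?m = "map_permutation UNIV \<beta>"
  have bij: "bij_betw \<beta> UNIV (range \<beta>)"
    using assms by (simp add: bij_betw_def)
  have inv_bij: "bij_betw (inv_into UNIV \<beta>) (range \<beta>) UNIV"
    by (rule bij_betw_inv_into[OF bij])
  have "bij_betw ?m {q. q permutes UNIV} {p. p permutes range \<beta>}"
  proof (rule bij_betw_byWitness[where f' = "map_permutation (range \<beta>) (inv_into UNIV \<beta>)"])
    show "\<forall>q\<in>{q. q permutes UNIV}. map_permutation (range \<beta>) (inv_into UNIV \<beta>) (?m q) = q"
      using map_permutation_compose_inv[OF bij] assms by simp
    show "\<forall>p\<in>{p. p permutes range \<beta>}. ?m (map_permutation (range \<beta>) (inv_into UNIV \<beta>) p) = p"
      using map_permutation_compose_inv[OF inv_bij] by (simp add: f_inv_into_f)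
  qed (use map_permutation_permutes[OF bij] map_permutation_permutes[OF inv_bij] in auto)
  then have "(\<Sum>p | p permutes range \<beta>.
            of_int (sign p) * (\<Prod>b\<in>range \<beta>. representation (range \<beta>) (f b) (p b))) =
     (\<Sum>q | q permutes UNIV. of_int (sign (?m q)) *
            (\<Prod>b\<in>range \<beta>. representation (range \<beta>) (f b) (?m q b)))"
    by (rule sum.reindex_bij_betw[symmetric])
  also have "\<dots> = (\<Sum>q | q permutes UNIV. of_int (sign q) *
            (\<Prod>i\<in>UNIV. representation (range \<beta>) (f (\<beta> i)) (\<beta> (q i))))"
  proof (rule sum.cong[OF refl])
    fix q :: "'n \<Rightarrow> 'n" assume "q \<in> {q. q permutes UNIV}"
    then have "sign (?m q) = sign q"
      using sign_map_permutation[OF assms, of q] by simp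
    then show "of_int (sign (?m q)) * (\<Prod>b\<in>range \<beta>. representation (range \<beta>) (f b) (?m q b)) =
        of_int (sign q) * (\<Prod>i\<in>UNIV. representation (range \<beta>) (f (\<beta> i)) (\<beta> (q i)))"
      by (simp add: prod.reindex[OF assms] map_permutation_apply[OF assms])
  qed
  finally show ?thesis
    by (simp add: det_def)
qed

text \<open>The basis that \<open>det_on\<close> picks by choice is unknown, so the value is found
  by a change of basis. The matrix \<open>M\<close> in the chosen basis is
  \<open>P ** D ** Q\<close>, where \<open>P\<close> and \<open>Q\<close> are mutually inverse
  transition matrices and \<open>D\<close> carries the eigenvalues.\<close>

lemma det_on_eigenbasis:
  fixes e :: "'n::finite \<Rightarrow> 'v::real_vector"
  assumes inj: "inj e" and ind: "independent (range e)" and span: "span (range e) = V"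
    and f: "linear f" and eigen: "\<And>i. f (e i) = l i *\<^sub>R e i"
  shows "det_on V f = (\<Prod>i\<in>UNIV. l i)"
proof -
  define B where "B = (SOME B. independent B \<and> span B = V)"
  have "independent B \<and> span B = V"
    unfolding B_def by (rule someI[of _ "range e"]) (use ind span in simp)
  then have B: "independent B" and spB: "span B = V" by auto
  have "B \<subseteq> span (range e)"
    using spB span span_superset by blast
  then have "finite B"
    using independent_span_bound[of "range e" B] B by simp
  have "card B = CARD('n)"
    using dim_eq_card_independent[OF B] dim_eq_card_independent[OF ind] dim_span[of B]
      dim_span[of "range e"] spB span card_image[OF inj] by simp
  then obtain \<beta> :: "'n \<Rightarrow> 'v" where \<beta>: "bij_betw \<beta> UNIV B"
    using finite_same_card_bij[OF finite_class.finite_UNIV \<open>finite B\<close>] by metis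
  then have inj\<beta>: "inj \<beta>" and ran: "range \<beta> = B"
    by (auto simp: bij_betw_def)
  have \<beta>V: "\<beta> i \<in> V" for i
    unfolding spB[symmetric] by (rule span_base) (simp flip: ran)
  have eV: "e i \<in> V" for i
    unfolding span[symmetric] by (rule span_base) simp
  define M where "M = (\<chi> i j. representation B (f (\<beta> i)) (\<beta> j))"
  define P where "P = (\<chi> i j. representation (range e) (\<beta> i) (e j))"
  define Q where "Q = (\<chi> i j. representation B (e i) (\<beta> j))"
  define D :: "real^'n^'n" where "D = (\<chi> i j. if i = j then l i else 0)"
  have \<beta>_e: "\<beta> i = (\<Sum>j\<in>UNIV. P$i$j *\<^sub>R e j)" for i
    using sum_representation_eq[OF ind, of "\<beta> i" "range e"] \<beta>V span
    by (simp add: sum.reindex[OF inj] P_def)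
  have rep_\<beta>: "representation B (\<Sum>j\<in>UNIV. c j *\<^sub>R e j) (\<beta> k) = (\<Sum>j\<in>UNIV. c j * Q$j$k)" for c k
    by (subst representation_sum[OF B])
       (simp_all add: representation_scale[OF B] eV spB subspace_scale[OF subspace_span, of _ B, unfolded spB] Q_def)
  have rep_basis: "representation B (\<beta> i) (\<beta> j) = (if \<beta> j = \<beta> i then 1 else 0)" for i j
    using representation_basis[OF B, of "\<beta> i"] ran by auto
  have "P ** Q = mat 1"
    using inj\<beta> by (simp add: vec_eq_iff matrix_matrix_mult_def mat_def rep_\<beta>[symmetric]
        \<beta>_e[symmetric] rep_basis inj_eq)
  then have PQ: "det P * det Q = 1"
    by (metis det_mul det_I)
  have "f (\<beta> i) = (\<Sum>j\<in>UNIV. (P$i$j * l j) *\<^sub>R e j)" for i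
    by (subst \<beta>_e) (simp add: linear_sum[OF f] linear_scale[OF f] eigen)
  then have "M = P ** D ** Q"
    by (simp add: M_def vec_eq_iff rep_\<beta>)
       (simp add: matrix_matrix_mult_def D_def if_distrib[of "\<lambda>x. _ * x"] cong: if_cong)
  then have "det M = det D"
    using PQ by (simp add: det_mul algebra_simps)
  also have "\<dots> = (\<Prod>i\<in>UNIV. l i)"
    by (subst det_diagonal) (simp_all add: D_def)
  finally show ?thesis
    unfolding det_on_def B_def[symmetric] Let_def M_def
    using det_on_eq_det[OF inj\<beta>, of f] ran by simp
qed

subsection \<open>The groups\<close>

lemma vector_4:
  "vector [a, b, c, d] $ (1::4) = a" "vector [a, b, c, d] $ (2::4) = b"
  "vector [a, b, c, d] $ (3::4) = c" "vector [a, b, c, d] $ (4::4) = d"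
  unfolding vector_def by simp_all

text \<open>The free coordinates are the entries (1,2), (2,3), (1,3) and (1,4). The symplectic
  relation of rows 1 and 3 forces the entry (3,4), that of rows 1 and 2 the entry (2,4).\<close>

definition N4_elt :: "'a::field \<Rightarrow> 'a \<Rightarrow> 'a \<Rightarrow> 'a \<Rightarrow> 'a^4^4" where
  "N4_elt x w p q = vector [vector [1, x, p, q],
                            vector [0, 1, w, p - x * w],
                            vector [0, 0, 1, - x],
                            vector [0, 0, 0, 1]]"

definition diag4 :: "'a::field \<Rightarrow> 'a \<Rightarrow> 'a^4^4" where
  "diag4 s t = vector [vector [s, 0, 0, 0],
                       vector [0, t, 0, 0],
                       vector [0, 0, inverse t, 0],
                       vector [0, 0, 0, inverse s]]"

lemmas matrix4_simps = vec_eq_iff forall_4 matrix_matrix_mult_def sum_4 vector_4 transpose_def mat_def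

lemma Sp4_iff: "g \<in> Sp4 \<longleftrightarrow> invertible g \<and> g ** J4 ** transpose g = J4"
  by (simp add: Sp4_def GL4_def)

lemma N4_elt_mult:
  "N4_elt x w p q ** N4_elt x' w' p' q' =
   N4_elt (x + x') (w + w') (p + p' + x * w') (q + q' + x * p' - x * x' * w' - p * x')"
  by (simp add: matrix4_simps N4_elt_def algebra_simps)

lemma N4_elt_0: "N4_elt 0 0 0 0 = mat 1"
  by (simp add: matrix4_simps N4_elt_def)

lemma N4_elt_inverse: "N4_elt x w p q ** N4_elt (-x) (-w) (x * w - p) (-q) = mat 1"
  unfolding N4_elt_mult N4_elt_0[symmetric] by (simp add: algebra_simps)

text \<open>The entry is the symplectic pairing of rows \<open>i\<close> and \<open>j\<close>, so
  membership in \<open>Sp4\<close> becomes a list of bilinear relations between rows.\<close>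

lemma symplectic_form_entry:
  "(g ** J4 ** transpose g)$i$j = g$i$1 * g$j$4 + g$i$2 * g$j$3 - g$i$3 * g$j$2 - g$i$4 * g$j$1"
  by (simp add: matrix_matrix_mult_def sum_4 vector_4 J4_def transpose_def)

lemma Sp4_I:
  assumes "g ** h = mat 1"
    and "\<And>i j. g$i$1 * g$j$4 + g$i$2 * g$j$3 - g$i$3 * g$j$2 - g$i$4 * g$j$1 = J4$i$j"
  shows "g \<in> Sp4"
proof -
  have "g ** J4 ** transpose g = J4"
    unfolding vec_eq_iff symplectic_form_entry using assms(2) by blast
  then show ?thesis
    using assms(1) by (auto simp: Sp4_iff invertible_right_inverse)
qed

lemma Sp4_D:
  assumes "g \<in> Sp4"
  shows "g$i$1 * g$j$4 + g$i$2 * g$j$3 - g$i$3 * g$j$2 - g$i$4 * g$j$1 = J4$i$j"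
  using assms symplectic_form_entry[of g i j] by (simp add: Sp4_iff)

lemma N4_elt_Sp4: "N4_elt x w p q \<in> Sp4"
proof (rule Sp4_I[OF N4_elt_inverse])
  fix i j :: 4
  show "N4_elt x w p q$i$1 * N4_elt x w p q$j$4 + N4_elt x w p q$i$2 * N4_elt x w p q$j$3
      - N4_elt x w p q$i$3 * N4_elt x w p q$j$2 - N4_elt x w p q$i$4 * N4_elt x w p q$j$1 = J4$i$j"
    using exhaust_4[of i] exhaust_4[of j]
    by (elim disjE) (simp_all add: N4_elt_def J4_def vector_4)
qed

lemma N4_eq: "N4 = {N4_elt x w p q | x w p q. True}"
proof (intro equalityI subsetI)
  fix g :: "'a^4^4" assume g: "g \<in> N4"
  then have sp: "g \<in> Sp4"
    by (simp add: N4_def)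
  have diag: "g$1$1 = 1" "g$2$2 = 1" "g$3$3 = 1" "g$4$4 = 1"
    and low: "g$2$1 = 0" "g$3$1 = 0" "g$3$2 = 0" "g$4$1 = 0" "g$4$2 = 0" "g$4$3 = 0"
    using g by (simp_all add: N4_def)
  have "g$3$4 = - g$1$2" "g$2$4 = g$1$3 - g$1$2 * g$2$3"
    using Sp4_D[OF sp, of 1 3] Sp4_D[OF sp, of 1 2]
    by (simp_all add: diag low J4_def vector_4 algebra_simps eq_neg_iff_add_eq_0)
  then have "g = N4_elt (g$1$2) (g$2$3) (g$1$3) (g$1$4)"
    by (simp add: vec_eq_iff forall_4 N4_elt_def vector_4 diag low)
  then show "g \<in> {N4_elt x w p q | x w p q. True}" by blast
next
  fix g :: "'a^4^4" assume "g \<in> {N4_elt x w p q | x w p q. True}"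
  then obtain x w p q where "g = N4_elt x w p q" by blast
  then show "g \<in> N4"
    using N4_elt_Sp4[of x w p q] by (simp add: N4_def forall_4 N4_elt_def vector_4)
qed

lemma diag4_inverse: "s \<noteq> 0 \<Longrightarrow> t \<noteq> 0 \<Longrightarrow> diag4 s t ** diag4 (inverse s) (inverse t) = mat 1"
  by (simp add: matrix4_simps diag4_def)

lemma diag4_Sp4:
  assumes "s \<noteq> 0" "t \<noteq> 0"
  shows "diag4 s t \<in> Sp4"
proof (rule Sp4_I[OF diag4_inverse[OF assms]])
  fix i j :: 4
  show "diag4 s t$i$1 * diag4 s t$j$4 + diag4 s t$i$2 * diag4 s t$j$3
      - diag4 s t$i$3 * diag4 s t$j$2 - diag4 s t$i$4 * diag4 s t$j$1 = J4$i$j"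
    using exhaust_4[of i] exhaust_4[of j] assms
    by (elim disjE) (simp_all add: diag4_def J4_def vector_4)
qed

lemma A4_eq: "A4 = {diag4 (of_real s) (of_real t) | s t. s > 0 \<and> t > 0}"
proof (intro equalityI subsetI)
  fix g :: "'a^4^4" assume g: "g \<in> A4"
  then have pos: "\<exists>x::real. x > 0 \<and> g$i$i = of_real x" for i
    by (simp add: A4_def)
  obtain s where s: "s > 0" "g$1$1 = of_real s"
    using pos[of 1] by blast
  obtain t where t: "t > 0" "g$2$2 = of_real t"
    using pos[of 2] by blast
  note st = s t
  have sp: "g \<in> Sp4" and off: "i \<noteq> j \<Longrightarrow> g$i$j = 0" for i j
    using g by (simp_all add: A4_def)
  \<comment> \<open>Rows 1 and 4 pair to 1, and so do rows 2 and 3.\<close>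
  have "g$3$3 = inverse (of_real t)" "g$4$4 = inverse (of_real s)"
    using Sp4_D[OF sp, of 1 4] Sp4_D[OF sp, of 2 3] st
    by (simp_all add: off J4_def vector_4 field_simps)
  then have "g = diag4 (of_real s) (of_real t)"
    using st by (simp add: vec_eq_iff forall_4 diag4_def vector_4 off)
  then show "g \<in> {diag4 (of_real s) (of_real t) | s t. s > 0 \<and> t > 0}" using st by blast
next
  fix g :: "'a^4^4" assume "g \<in> {diag4 (of_real s) (of_real t) | s t. s > 0 \<and> t > 0}"
  then obtain s t where st: "s > 0" "t > 0" "g = diag4 (of_real s) (of_real t)" by blast
  have *: "\<exists>x::real. x > 0 \<and> of_real u = (of_real x :: 'a)"
    "\<exists>x::real. x > 0 \<and> inverse (of_real u) = (of_real x :: 'a)" if "u > 0" for u :: real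
    using that by (auto intro: exI[of _ u] exI[of _ "inverse u"])
  have "g \<in> Sp4"
    using st diag4_Sp4[of "of_real s :: 'a" "of_real t"] by simp
  moreover have "\<forall>i j. i \<noteq> j \<longrightarrow> g$i$j = 0"
    unfolding forall_4 st(3) by (simp add: diag4_def vector_4)
  moreover have "\<forall>i. \<exists>x::real. x > 0 \<and> g$i$i = of_real x"
    unfolding forall_4 st(3) using *[OF st(1)] *[OF st(2)] by (simp add: diag4_def vector_4)
  ultimately show "g \<in> A4"
    unfolding A4_def by blast
qed

section \<open>The commutator subgroup of N\<close>

lemma commN4_elt_eq: "commN4_elt y z = N4_elt 0 0 y z"
  by (simp add: commN4_elt_def N4_elt_def)

lemma group_GL4: "group GL4"
proof (rule groupI)
  fix x :: "'a^4^4" assume "x \<in> carrier GL4"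
  then obtain y where "x ** y = mat 1" "y ** x = mat 1"
    by (auto simp: GL4_def invertible_def)
  then show "\<exists>y\<in>carrier GL4. y \<otimes>\<^bsub>GL4\<^esub> x = \<one>\<^bsub>GL4\<^esub>"
    by (intro bexI[of _ y]) (auto simp: GL4_def invertible_def)
qed (simp_all add: GL4_def invertible_mult matrix_mul_assoc invertible_right_inverse[of "mat 1"] exI[of _ "mat 1"])

lemma GL4_inv:
  assumes "g ** h = mat 1"
  shows "inv\<^bsub>GL4\<^esub> g = h"
proof (rule group.inv_equality[OF group_GL4])
  have "h ** g = mat 1"
    using assms matrix_left_right_inverse by blast
  then show "h \<otimes>\<^bsub>GL4\<^esub> g = \<one>\<^bsub>GL4\<^esub>" "g \<in> carrier GL4" "h \<in> carrier GL4"
    using assms by (auto simp: GL4_def invertible_def)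
qed

text \<open>The first two coordinates are additive under \<open>N4_elt_mult\<close>, hence they
  cancel in every commutator.\<close>

lemma N4_commutator:
  "N4_elt x w p q \<otimes>\<^bsub>GL4\<^esub> N4_elt x' w' p' q' \<otimes>\<^bsub>GL4\<^esub> (inv\<^bsub>GL4\<^esub> N4_elt x w p q)
     \<otimes>\<^bsub>GL4\<^esub> (inv\<^bsub>GL4\<^esub> N4_elt x' w' p' q') \<in> range (\<lambda>(y, z). commN4_elt y z)"
  unfolding GL4_inv[OF N4_elt_inverse]
  by (auto simp: GL4_def N4_elt_mult commN4_elt_eq)

text \<open>Every element of the group is a single commutator; solving for it needs to divide by \<open>2\<close>.\<close>

lemma commN4_eq: "commN4 = range (\<lambda>(y, z). commN4_elt y z :: 'a::field_char_0^4^4)"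
proof
  let ?R = "range (\<lambda>(y, z). commN4_elt y z :: 'a^4^4)"
  have "subgroup ?R GL4"
  proof
    show "?R \<subseteq> carrier GL4"
      using N4_elt_Sp4 by (auto simp: commN4_elt_eq Sp4_def)
    fix a b assume "a \<in> ?R" "b \<in> ?R"
    then obtain y z y' z' where ab: "a = N4_elt 0 0 y z" "b = N4_elt 0 0 y' z'"
      by (auto simp: commN4_elt_eq)
    show "a \<otimes>\<^bsub>GL4\<^esub> b \<in> ?R"
      by (auto simp: ab GL4_def N4_elt_mult commN4_elt_eq)
    show "inv\<^bsub>GL4\<^esub> a \<in> ?R"
      unfolding ab GL4_inv[OF N4_elt_inverse] by (auto simp: commN4_elt_eq)
  next
    have "\<one>\<^bsub>GL4\<^esub> = commN4_elt (0::'a) 0"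
      by (simp add: GL4_def commN4_elt_eq N4_elt_0)
    then show "\<one>\<^bsub>GL4\<^esub> \<in> ?R"
      by auto
  qed
  moreover have "derived_set GL4 N4 \<subseteq> ?R"
    unfolding N4_eq using N4_commutator by blast
  ultimately show "commN4 \<subseteq> ?R"
    unfolding commN4_def derived_def by (intro group.generate_subgroup_incl[OF group_GL4])
next
  show "range (\<lambda>(y, z). commN4_elt y z :: 'a^4^4) \<subseteq> commN4"
  proof clarify
    fix y z :: 'a
    \<comment> \<open>If the third coordinate of \<open>?h\<close> is \<open>p\<close>, the
      commutator is \<open>commN4_elt y (2 * p + y)\<close>; this dictates
      \<open>p = (z - y) / 2\<close>.\<close>
    let ?g = "N4_elt 1 0 0 0 :: 'a^4^4" and ?h = "N4_elt 0 y ((z - y) / 2) 0"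
    have "commN4_elt y z = ?g \<otimes>\<^bsub>GL4\<^esub> ?h \<otimes>\<^bsub>GL4\<^esub> (inv\<^bsub>GL4\<^esub> ?g) \<otimes>\<^bsub>GL4\<^esub> (inv\<^bsub>GL4\<^esub> ?h)"
      unfolding GL4_inv[OF N4_elt_inverse]
      by (simp add: GL4_def N4_elt_mult commN4_elt_eq)
    then show "commN4_elt y z \<in> commN4"
      unfolding commN4_def derived_def N4_eq by (intro generate.incl) blast
  qed
qed

subsection \<open>The Lie algebra of the unipotent radical\<close>

lemma matrix_inv_eqI:
  fixes A :: "'a::field^'n^'n"
  assumes "A ** B = mat 1"
  shows "matrix_inv A = B"
proof -
  have BA: "B ** A = mat 1"
    using assms matrix_left_right_inverse by blast
  have "A ** matrix_inv A = mat 1 \<and> matrix_inv A ** A = mat 1"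
    unfolding matrix_inv_def by (rule someI[of _ B]) (use assms BA in simp)
  then have "matrix_inv A = B ** A ** matrix_inv A"
    by (simp add: BA)
  also have "\<dots> = B"
    using \<open>A ** matrix_inv A = mat 1 \<and> _\<close> by (simp flip: matrix_mul_assoc)
  finally show ?thesis .
qed

lemma linear_Ad: "linear (Ad g)"
  by (rule linearI)
     (simp_all add: Ad_def vec_eq_iff matrix_matrix_mult_def scaleR_sum_right sum_distrib_right
        distrib_left distrib_right sum.distrib)

text \<open>The differential of \<open>N4_elt\<close> at the identity: the coordinates keep their
  order and the quadratic term \<open>x * w\<close> disappears.\<close>

definition n4_elt :: "'a::field^4 \<Rightarrow> 'a^4^4" where
  "n4_elt v = vector [vector [0, v$1, v$3, v$4],
                      vector [0, 0, v$2, v$3],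
                      vector [0, 0, 0, - v$1],
                      vector [0, 0, 0, 0]]"

lemma linear_n4_elt: "linear (n4_elt :: 'a::real_normed_field^4 \<Rightarrow> _)"
  by (rule linearI) (simp_all add: n4_elt_def vec_eq_iff forall_4 vector_4)

lemma inj_n4_elt: "inj n4_elt"
  by (rule injI) (simp add: n4_elt_def vec_eq_iff forall_4 vector_4)

lemma n4_elt_mem_lie_algebra: "n4_elt v \<in> lie_algebra N4"
proof -
  let ?\<gamma> = "\<lambda>t. N4_elt (t *\<^sub>R v$1) (t *\<^sub>R v$2) (t *\<^sub>R v$3) (t *\<^sub>R v$4)"
  \<comment> \<open>The curve is affine in \<open>t\<close> except for the entry (2,4), whose
    product term contributes the second-order matrix \<open>Y\<close>.\<close>
  define Y :: "'a^4^4" where "Y = (\<chi> i j. if i = 2 \<and> j = 4 then - v$1 * v$2 else 0)"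
  have \<gamma>: "?\<gamma> = (\<lambda>t. mat 1 + t *\<^sub>R n4_elt v + t^2 *\<^sub>R Y)"
    by (rule ext) (simp add: N4_elt_def n4_elt_def Y_def vec_eq_iff forall_4 vector_4 mat_def power2_eq_square)
  have "(?\<gamma> has_vector_derivative n4_elt v) (at 0)"
    unfolding \<gamma> by (auto intro!: derivative_eq_intros)
  then show ?thesis
    unfolding lie_algebra_def N4_eq by (intro CollectI exI[of _ ?\<gamma>]) (auto simp: N4_elt_0)
qed

lemma lie_algebra_N4: "lie_algebra N4 = range (n4_elt :: 'a::real_normed_field^4 \<Rightarrow> _)"
proof (intro equalityI subsetI)
  fix X :: "'a^4^4" assume "X \<in> lie_algebra N4"
  then obtain \<gamma> where \<gamma>: "\<And>t. \<gamma> t \<in> N4" "\<gamma> 0 = mat 1" "(\<gamma> has_vector_derivative X) (at 0)"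
    unfolding lie_algebra_def by blast
  have der: "((\<lambda>t. \<gamma> t$i$j) has_vector_derivative X$i$j) (at 0)" for i j
    using \<gamma>(3) by (intro bounded_linear.has_vector_derivative[OF bounded_linear_vec_nth])
  have const: "X$i$j = 0" if "\<And>t. \<gamma> t$i$j = c" for i j c
    using vector_derivative_unique_at[OF der[of i j], of 0] that by (simp add: has_vector_derivative_const)
  have entries: "\<gamma> t$i$i = 1" "\<gamma> t$2$1 = 0" "\<gamma> t$3$1 = 0" "\<gamma> t$3$2 = 0" "\<gamma> t$4$1 = 0" "\<gamma> t$4$2 = 0"
    "\<gamma> t$4$3 = 0" for t i
    using \<gamma>(1)[of t] by (simp_all add: N4_def)
  have rel: "\<gamma> t$3$4 = - \<gamma> t$1$2" "\<gamma> t$2$4 = \<gamma> t$1$3 - \<gamma> t$1$2 * \<gamma> t$2$3" for t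
    using \<gamma>(1)[of t] by (auto simp: N4_eq N4_elt_def vector_4)
  have "X$3$4 = - X$1$2"
    by (rule vector_derivative_unique_at[OF der]) (auto simp: rel intro!: derivative_eq_intros der)
  \<comment> \<open>Both factors of the product in \<open>rel\<close> vanish at 0, since the curve
    starts at the identity, so the product has derivative 0 there.\<close>
  moreover have "X$2$4 = X$1$3"
    by (rule vector_derivative_unique_at[OF der])
       (auto simp: rel \<gamma>(2) mat_def intro!: derivative_eq_intros der)
  ultimately have "X = n4_elt (vector [X$1$2, X$2$3, X$1$3, X$1$4])"
    by (simp add: n4_elt_def vec_eq_iff forall_4 vector_4 const[OF entries(1)] const[OF entries(2)]
        const[OF entries(3)] const[OF entries(4)] const[OF entries(5)] const[OF entries(6)]
        const[OF entries(7)])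
  then show "X \<in> range n4_elt" by blast
qed (auto simp: n4_elt_mem_lie_algebra)

text \<open>The values at \<open>diag4 s t\<close> of the four positive roots, in the order of the
  coordinates of \<open>n4_elt\<close>.\<close>

definition n4_weight :: "real \<Rightarrow> real \<Rightarrow> real^4" where
  "n4_weight s t = vector [s / t, t\<^sup>2, s * t, s\<^sup>2]"

lemma Ad_diag4_n4_elt:
  assumes "s > 0" "t > 0"
  shows "Ad (diag4 (of_real s) (of_real t)) (n4_elt (axis i u)) =
    n4_weight s t $ i *\<^sub>R n4_elt (axis i u :: 'a::real_normed_field^4)"
proof -
  have inv: "matrix_inv (diag4 (of_real s) (of_real t)) = (diag4 (inverse (of_real s)) (inverse (of_real t)) :: 'a^4^4)"
    using assms by (intro matrix_inv_eqI diag4_inverse) auto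
  show ?thesis
    using assms exhaust_4[of i] unfolding Ad_def inv vec_eq_iff vector_scaleR_component
    unfolding scaleR_conv_of_real
    by (elim disjE)
       (simp_all add: diag4_def n4_elt_def n4_weight_def axis_def matrix_matrix_mult_def sum_4
          forall_4 vector_4 power2_eq_square field_simps)
qed

lemma prod_4: "prod f (UNIV :: 4 set) = f 1 * f 2 * f 3 * f 4"
  unfolding UNIV_4 by (simp add: ac_simps)

text \<open>The vectors \<open>n4_elt (axis i (\<kappa> k))\<close> form a real eigenbasis in which
  each root occurs \<open>DIM('a)\<close> times. The product of the four roots is the square of
  \<open>s\<^sup>2 * t\<close>. The map \<open>\<kappa>\<close> supplies the finite index type that
  \<open>det_on_eigenbasis\<close> asks for.\<close>

lemma rho_power_diag4:
  fixes \<kappa> :: "'k::finite \<Rightarrow> 'a::{real_normed_field, euclidean_space}"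
  assumes \<kappa>: "bij_betw \<kappa> UNIV Basis" and st: "s > 0" "t > 0"
  shows "rho_power (diag4 (of_real s) (of_real t) :: 'a^4^4) = (s\<^sup>2 * t) ^ DIM('a)"
proof -
  define e where "e = (\<lambda>(i, k). n4_elt (axis i (\<kappa> k)))"
  have \<kappa>_inj: "\<kappa> k = \<kappa> k' \<longleftrightarrow> k = k'" and \<kappa>_ran: "range \<kappa> = Basis" for k k'
    using \<kappa> by (auto simp: bij_betw_def inj_eq)
  have \<kappa>_nz: "\<kappa> k \<noteq> 0" for k
    using \<kappa>_ran nonzero_Basis by blast
  have "inj e"
    by (rule injI) (auto simp: e_def inj_eq[OF inj_n4_elt] axis_eq_axis \<kappa>_inj \<kappa>_nz)
  have ran: "range e = n4_elt ` Basis"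
    by (auto simp: e_def Basis_vec_def simp flip: \<kappa>_ran)
  have "det_on (lie_algebra N4) (Ad (diag4 (of_real s) (of_real t) :: 'a^4^4)) =
    (\<Prod>ik\<in>(UNIV :: (4 \<times> 'k) set). n4_weight s t $ fst ik)"
  proof (rule det_on_eigenbasis[OF \<open>inj e\<close> _ _ linear_Ad])
    show "independent (range e)"
      unfolding ran
      by (intro linear_independent_injective_image linear_n4_elt independent_Basis)
         (simp add: inj_n4_elt)
    show "span (range e) = lie_algebra N4"
      unfolding ran linear_span_image[OF linear_n4_elt] lie_algebra_N4 by simp
    show "Ad (diag4 (of_real s) (of_real t)) (e ik) = n4_weight s t $ fst ik *\<^sub>R e ik" for ik
      by (cases ik) (simp add: e_def Ad_diag4_n4_elt[OF st])
  qed
  also have "\<dots> = (\<Prod>i\<in>UNIV. n4_weight s t $ i) ^ CARD('k)"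
    using prod.cartesian_product[of "\<lambda>i _. n4_weight s t $ i" "UNIV :: 'k set" UNIV]
    by (simp add: split_def prod_power_distrib)
  also have "CARD('k) = DIM('a)"
    using bij_betw_same_card[OF \<kappa>] by simp
  also have "(\<Prod>i\<in>UNIV. n4_weight s t $ i) = (s\<^sup>2 * t)\<^sup>2"
    using st by (simp only: prod_4 n4_weight_def vector_4) (simp add: power2_eq_square field_simps)
  also have "((s\<^sup>2 * t)\<^sup>2) ^ DIM('a) = ((s\<^sup>2 * t) ^ DIM('a))\<^sup>2"
    by (simp only: power_mult[symmetric] mult.commute)
  finally show ?thesis
    unfolding rho_power_def using st(2) by (simp only: real_sqrt_abs) simp
qed

subsection \<open>The Iwasawa decomposition\<close>

lemma Sp4_mult:
  assumes "g \<in> Sp4" "h \<in> Sp4"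
  shows "g ** h \<in> Sp4"
proof -
  have "g ** h ** J4 ** transpose (g ** h) = g ** (h ** J4 ** transpose h) ** transpose g"
    by (simp add: matrix_transpose_mul matrix_mul_assoc)
  then show ?thesis
    using assms by (simp add: Sp4_iff invertible_mult)
qed

lemma transpose_N4_elt_inverse:
  "transpose (N4_elt x w p q) ** transpose (N4_elt (-x) (-w) (x * w - p) (-q)) = mat 1"
  using N4_elt_inverse[of "-x" "-w" "x * w - p" "-q"]
  by (simp add: matrix_transpose_mul[symmetric])

lemma transpose_N4_elt_Sp4: "transpose (N4_elt x w p q) \<in> Sp4"
proof (rule Sp4_I[OF transpose_N4_elt_inverse])
  fix i j :: 4
  let ?g = "transpose (N4_elt x w p q)"
  show "?g$i$1 * ?g$j$4 + ?g$i$2 * ?g$j$3 - ?g$i$3 * ?g$j$2 - ?g$i$4 * ?g$j$1 = J4$i$j"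
    using exhaust_4[of i] exhaust_4[of j]
    by (elim disjE) (simp_all add: transpose_def N4_elt_def J4_def vector_4 algebra_simps)
qed

text \<open>The \<open>LDU\<close> decomposition of \<open>n n\<^sup>*\<close>, with \<open>Y\<close> and \<open>Z\<close> in the roles of the conjugates of
  \<open>y\<close> and \<open>z\<close>; \<open>D\<close> and \<open>E\<close> are the first two leading principal minors.\<close>

lemma gram_commN4_elt:
  fixes y Y z Z D E :: "'a::field"
  assumes D: "D = 1 + y * Y + z * Z" "D \<noteq> 0" and E: "E = (1 + y * Y)\<^sup>2 + z * Z" "E \<noteq> 0"
  shows "transpose (N4_elt (y * Z / D) (- (Y\<^sup>2 * z) / E) (Y / D) (Z / D)) ** diag4 D (E / D) **
      N4_elt (Y * z / D) (- (y\<^sup>2 * Z) / E) (y / D) (z / D) =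
    commN4_elt y z ** transpose (commN4_elt Y Z)"
proof -
  \<comment> \<open>This identity collapses the (2,4) entries of the two unipotent factors, computed
    in \<open>s\<close>, to single fractions over \<open>E\<close>.\<close>
  have DE: "D * (1 + y * Y) = E + (y * Y) * (z * Z)"
    by (simp add: D E power2_eq_square algebra_simps)
  have s: "Y / D - y * Z / D * (- (Y\<^sup>2 * z) / E) = Y * (1 + y * Y) / E"
    "y / D - Y * z / D * (- (y\<^sup>2 * Z) / E) = y * (1 + y * Y) / E"
    using DE D(2) E(2) by (simp_all add: divide_simps, algebra+)
  show ?thesis
    using D(2) E(2)
    unfolding N4_elt_def s diag4_def commN4_elt_def
    by (simp add: matrix_matrix_mult_def transpose_def sum_4 vec_eq_iff forall_4 vector_4,
        intro conjI, simp_all add: divide_simps,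
        simp_all add: D(1) E(1) power2_eq_square algebra_simps)
qed

text \<open>The involution is the identity for the reals and \<open>cnj\<close> for the complex
  numbers. The one-sided condition in \<open>K_iff\<close> then describes orthogonal and unitary
  matrices alike, since a right inverse of a square matrix is two-sided.\<close>

locale iwasawa_involution =
  fixes cj :: "'a::{real_normed_field, euclidean_space} \<Rightarrow> 'a" and K :: "('a^4^4) set"
  assumes cj_add: "cj (x + y) = cj x + cj y"
    and cj_mult: "cj (x * y) = cj x * cj y"
    and cj_of_real: "cj (of_real u) = of_real u"
    and cj_cj: "cj (cj x) = x"
    and mult_cj: "x * cj x = of_real ((norm x)\<^sup>2)"
    and K_iff: "g \<in> K \<longleftrightarrow> g \<in> Sp4 \<and> g ** (\<chi> i j. cj (g$j$i)) = mat 1"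
begin

definition ctr :: "'a^4^4 \<Rightarrow> 'a^4^4" where
  "ctr g = (\<chi> i j. cj (g$j$i))"

lemma cj_0: "cj 0 = 0" and cj_1: "cj 1 = 1"
  using cj_of_real[of 0] cj_of_real[of 1] by simp_all

lemma cj_minus: "cj (- x) = - cj x"
  using cj_add[of x "- x"] cj_0 by (simp add: eq_neg_iff_add_eq_0 add.commute)

lemma cj_divide_of_real: "cj (x / of_real u) = cj x / of_real u"
proof -
  have "cj (x * of_real (inverse u)) = cj x * of_real (inverse u)"
    by (simp only: cj_mult cj_of_real)
  then show ?thesis by (simp add: divide_inverse)
qed

lemma ctr_mult: "ctr (A ** B) = ctr B ** ctr A"
  by (simp add: ctr_def vec_eq_iff matrix_matrix_mult_def sum_4 cj_add cj_mult mult.commute)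

lemma ctr_1: "ctr (mat 1) = mat 1"
  by (simp add: ctr_def mat_def vec_eq_iff cj_0 cj_1)

lemma ctr_transpose_N4_elt:
  "ctr (transpose (N4_elt x w p q)) = N4_elt (cj x) (cj w) (cj p) (cj q)"
  using cj_add[of p "- (x * w)"]
  by (simp add: ctr_def N4_elt_def transpose_def vec_eq_iff forall_4 vector_4 cj_0 cj_1 cj_minus cj_mult)

lemma ctr_commN4_elt: "ctr (commN4_elt y z) = transpose (commN4_elt (cj y) (cj z))"
  by (simp add: ctr_def commN4_elt_def transpose_def vec_eq_iff forall_4 vector_4 cj_0 cj_1)

lemma diag4_ctr:
  "diag4 (of_real s) (of_real t) ** ctr (diag4 (of_real s) (of_real t)) =
     diag4 (of_real (s\<^sup>2)) (of_real (t\<^sup>2))"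
  using cj_of_real[of "inverse s"] cj_of_real[of "inverse t"]
  by (simp add: ctr_def diag4_def matrix_matrix_mult_def sum_4 vec_eq_iff forall_4 vector_4 cj_0
      cj_of_real power2_eq_square)

lemma Nbar4_eq: "Nbar4 = {transpose (N4_elt x w p q) | x w p q. True}"
  unfolding Nbar4_def N4_eq by blast

text \<open>The compact factor drops out of the Gram matrix, which reduces the Iwasawa decomposition
  to an LDU decomposition.\<close>

lemma gram_iwasawa:
  assumes "k \<in> K" "g = l ** a ** k"
  shows "g ** ctr g = l ** (a ** ctr a) ** ctr l"
proof -
  have "g ** ctr g = l ** a ** (k ** ctr k) ** ctr a ** ctr l"
    by (simp add: assms(2) ctr_mult matrix_mul_assoc)
  also have "k ** ctr k = mat 1"
    using assms(1) by (simp add: K_iff ctr_def)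
  finally show ?thesis
    by (simp add: matrix_mul_assoc)
qed

text \<open>Entry (1,1) gives \<open>S\<close>, then entry (2,1) gives the coordinate
  \<open>x\<close> because \<open>S\<close> is nonzero, and entry (2,2) leaves \<open>T\<close>.
  These two parameters determine the diagonal factor.\<close>

lemma ldu_unique:
  assumes "transpose (N4_elt x w p q) ** diag4 S T ** ctr (transpose (N4_elt x w p q)) =
    transpose (N4_elt x' w' p' q') ** diag4 S' T' ** ctr (transpose (N4_elt x' w' p' q'))"
    (is "?L = ?R") and "S \<noteq> 0"
  shows "S = S' \<and> T = T'"
proof -
  have "?L$1$1 = ?R$1$1" "?L$2$1 = ?R$2$1" "?L$2$2 = ?R$2$2"
    using assms(1) by simp_all
  then have "S = S'" "x * S = x' * S'" "x * S * cj x + T = x' * S' * cj x' + T'"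
    unfolding ctr_transpose_N4_elt
    by (simp_all add: N4_elt_def diag4_def matrix_matrix_mult_def transpose_def
        sum_4 vector_4)
  then show ?thesis
    using assms(2) by simp
qed

lemma iwasawa_a_commN4_elt:
  fixes y z :: 'a
  defines "d \<equiv> 1 + (norm y)\<^sup>2 + (norm z)\<^sup>2" and "e \<equiv> (1 + (norm y)\<^sup>2)\<^sup>2 + (norm z)\<^sup>2"
  shows "iwasawa_a K (commN4_elt y z) = diag4 (of_real (sqrt d)) (of_real (sqrt (e / d)))"
proof -
  have "d > 0" by (simp add: d_def add_pos_nonneg)
  have "e > 0" by (simp add: e_def add_pos_nonneg[OF zero_less_power[OF add_pos_nonneg]])
  define D E :: 'a where "D = of_real d" and "E = of_real e"
  have nz: "D \<noteq> 0" "E \<noteq> 0" using \<open>d > 0\<close> \<open>e > 0\<close> by (simp_all add: D_def E_def)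
  \<comment> \<open>The lower factor of \<open>gram_commN4_elt\<close> with the conjugates of
    \<open>y\<close> and \<open>z\<close> substituted for \<open>Y\<close> and
    \<open>Z\<close>.\<close>
  define x w p q where "x = y * cj z / D" "w = - ((cj y)\<^sup>2 * z) / E" "p = cj y / D" "q = cj z / D"
  define l where "l = transpose (N4_elt x w p q)"
  define li where "li = transpose (N4_elt (-x) (-w) (x * w - p) (-q))"
  define a where "a = (diag4 (of_real (sqrt d)) (of_real (sqrt (e / d))) :: 'a^4^4)"
  define ai where "ai = (diag4 (inverse (of_real (sqrt d))) (inverse (of_real (sqrt (e / d)))) :: 'a^4^4)"
  define n where "n = commN4_elt y z"
  \<comment> \<open>The decomposition is solved for its last factor; the Gram identity then shows
    that \<open>k\<close> is unitary.\<close>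
  define k where "k = ai ** li ** n"
  have "l ** li = mat 1"
    unfolding l_def li_def by (rule transpose_N4_elt_inverse)
  then have lil: "li ** l = mat 1"
    using matrix_left_right_inverse by blast
  have "a ** ai = mat 1"
    unfolding a_def ai_def using \<open>d > 0\<close> \<open>e > 0\<close> by (intro diag4_inverse) auto
  then have aia: "ai ** a = mat 1"
    using matrix_left_right_inverse by blast
  have aA: "a \<in> A4"
    unfolding a_def A4_eq using \<open>d > 0\<close> \<open>e > 0\<close> by force
  have lN: "l \<in> Nbar4"
    unfolding l_def Nbar4_eq by blast
  have cjs: "cj x = cj y * z / D" "cj w = - (y\<^sup>2 * cj z) / E" "cj p = y / D" "cj q = z / D"
    by (simp_all add: x_w_p_q_def D_def E_def cj_divide_of_real cj_mult cj_cj cj_minus power2_eq_square)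
  have aa: "a ** ctr a = diag4 D (E / D)"
    unfolding a_def diag4_ctr using \<open>d > 0\<close> \<open>e > 0\<close> by (simp add: D_def E_def)
  have DE: "D = 1 + y * cj y + z * cj z" "E = (1 + y * cj y)\<^sup>2 + z * cj z"
    by (simp_all add: D_def E_def d_def e_def mult_cj)
  have gram: "n ** ctr n = l ** (a ** ctr a) ** ctr l"
    unfolding aa l_def ctr_transpose_N4_elt cjs n_def ctr_commN4_elt
    unfolding x_w_p_q_def
    by (rule gram_commN4_elt[OF DE(1) nz(1) DE(2) nz(2), symmetric])
  have "ctr l ** ctr li = mat 1" "ctr a ** ctr ai = mat 1"
    by (simp_all flip: ctr_mult add: lil aia ctr_1)
  have "k ** ctr k = ai ** li ** (n ** ctr n) ** ctr li ** ctr ai"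
    by (simp add: k_def ctr_mult matrix_mul_assoc)
  also have "\<dots> = ai ** (li ** l) ** a ** ctr a ** (ctr l ** ctr li) ** ctr ai"
    unfolding gram by (simp add: matrix_mul_assoc)
  also have "\<dots> = ai ** a ** (ctr a ** ctr ai)"
    unfolding lil \<open>ctr l ** ctr li = mat 1\<close> by (simp add: matrix_mul_assoc)
  also have "\<dots> = mat 1"
    unfolding aia \<open>ctr a ** ctr ai = mat 1\<close> by simp
  finally have "k ** ctr k = mat 1" .
  moreover have "ai \<in> Sp4"
    unfolding ai_def using \<open>d > 0\<close> \<open>e > 0\<close> by (intro diag4_Sp4) auto
  then have "k \<in> Sp4"
    unfolding k_def n_def li_def commN4_elt_eq
    by (intro Sp4_mult transpose_N4_elt_Sp4 N4_elt_Sp4)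
  ultimately have kK: "k \<in> K"
    by (simp add: K_iff ctr_def)
  have "l ** a ** k = l ** (a ** ai) ** li ** n"
    by (simp add: k_def matrix_mul_assoc)
  then have n: "n = l ** a ** k"
    by (simp add: \<open>a ** ai = mat 1\<close> \<open>l ** li = mat 1\<close>)
  show ?thesis
    unfolding iwasawa_a_def n_def[symmetric] a_def[symmetric]
  proof (rule the_equality)
    show "a \<in> A4 \<and> (\<exists>nbar\<in>Nbar4. \<exists>k\<in>K. n = nbar ** a ** k)"
      using aA lN kK n by blast
  next
    fix a' assume "a' \<in> A4 \<and> (\<exists>nbar\<in>Nbar4. \<exists>k\<in>K. n = nbar ** a' ** k)"
    then obtain l' k' where a': "a' \<in> A4" "l' \<in> Nbar4" "k' \<in> K" "n = l' ** a' ** k'" by blast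
    then obtain s t where st: "s > 0" "t > 0" "a' = diag4 (of_real s) (of_real t)"
      unfolding A4_eq by blast
    obtain x' w' p' q' where l': "l' = transpose (N4_elt x' w' p' q')"
      using a'(2) unfolding Nbar4_eq by blast
    have "l ** diag4 D (E / D) ** ctr l = l' ** diag4 (of_real (s\<^sup>2)) (of_real (t\<^sup>2)) ** ctr l'"
      using gram gram_iwasawa[OF a'(3,4)] by (simp add: aa st(3) diag4_ctr)
    then have "D = of_real (s\<^sup>2) \<and> E / D = of_real (t\<^sup>2)"
      unfolding l_def l' using ldu_unique nz(1) by blast
    then have "d = s\<^sup>2 \<and> e / d = t\<^sup>2"
      unfolding D_def E_def of_real_divide[symmetric] of_real_eq_iff .
    \<comment> \<open>Positivity of \<open>s\<close> and \<open>t\<close> singles out the square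
      roots, which makes the description in \<open>iwasawa_a\<close> unique.\<close>
    then have "sqrt d = s" "sqrt (e / d) = t"
      using st(1,2) by (auto intro: real_sqrt_unique)
    then show "a' = a"
      by (simp add: a_def st(3))
  qed
qed

end

subsection \<open>Integral estimates\<close>

text \<open>For \<open>r \<le> 0\<close> the left side is at most 1. For \<open>r > 0\<close> the
  logarithm is bounded by a small power of \<open>P\<close>, chosen so that its \<open>r\<close>-th
  power is \<open>P powr c\<close>.\<close>

lemma log_powr_bound:
  fixes c r :: real
  assumes "c > 0"
  obtains C where "C \<ge> 0" "\<And>P. P \<ge> 1 \<Longrightarrow> (1 + ln P) powr r \<le> C * P powr c"
proof (cases "r \<le> 0")
  case True
  show ?thesis
  proof (rule that[of 1])
    fix P :: real assume P: "P \<ge> 1"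
    have "(1 + ln P) powr r \<le> (1 + ln P) powr 0"
      using P True by (intro powr_mono) auto
    also have "\<dots> \<le> 1 * P powr c"
      using P assms by (auto simp: ge_one_powr_ge_zero)
    finally show "(1 + ln P) powr r \<le> 1 * P powr c" .
  qed simp
next
  case False
  define \<delta> where "\<delta> = c / r"
  have \<delta>: "\<delta> > 0" using False assms by (simp add: \<delta>_def)
  show ?thesis
  proof (rule that[of "(1 + 1 / \<delta>) powr r"])
    fix P :: real assume P: "P \<ge> 1"
    have "ln (P powr \<delta>) \<le> P powr \<delta> - 1"
      using P by (intro ln_le_minus_one) auto
    then have "ln P \<le> (1 / \<delta>) * P powr \<delta>"
      using P \<delta> by (simp add: ln_powr field_simps)
    moreover have "1 \<le> P powr \<delta>"
      using P \<delta> by (simp add: ge_one_powr_ge_zero)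
    ultimately have "1 + ln P \<le> (1 + 1 / \<delta>) * P powr \<delta>"
      unfolding distrib_right by linarith
    then have "(1 + ln P) powr r \<le> ((1 + 1 / \<delta>) * P powr \<delta>) powr r"
      using P False by (intro powr_mono2) auto
    also have "\<dots> = (1 + 1 / \<delta>) powr r * P powr c"
      using \<delta> False by (simp add: powr_mult powr_powr) (simp add: \<delta>_def)
    finally show "(1 + ln P) powr r \<le> (1 + 1 / \<delta>) powr r * P powr c" .
  qed simp
qed

text \<open>The integrand is dominated by a multiple of
  \<open>(1 + \<bar>u\<bar>) powr (- 6 / 5)\<close>, whose half-line integral is computed from an
  antiderivative; the other half-line follows by reflection.\<close>

lemma nn_integral_one_plus_square_powr:
  "(\<integral>\<^sup>+u. ennreal ((1 + u\<^sup>2) powr (- 3 / 5)) \<partial>lborel) < \<infinity>"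
proof -
  let ?g = "\<lambda>u::real. ennreal ((1 + u) powr (- 6 / 5)) * indicator {0..} u"
  have "(\<integral>\<^sup>+u. ?g u \<partial>lborel) = ennreal (0 - - 5 * (1 + 0) powr (- 1 / 5))"
  proof (rule nn_integral_FTC_atLeast[where F = "\<lambda>u. - 5 * (1 + u) powr (- 1 / 5)"])
    show "((\<lambda>u::real. - 5 * (1 + u) powr (- 1 / 5)) \<longlongrightarrow> 0) at_top"
      by real_asymp
    fix u :: real assume "0 \<le> u"
    then show "((\<lambda>u. - 5 * (1 + u) powr (- 1 / 5)) has_real_derivative (1 + u) powr (- 6 / 5)) (at u)"
      by (auto intro!: derivative_eq_intros simp: powr_diff[symmetric] powr_mult_base field_simps)
  qed auto
  then have g: "(\<integral>\<^sup>+u. ?g u \<partial>lborel) < \<infinity>"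
    by simp
  have g': "(\<integral>\<^sup>+u. ?g (- u) \<partial>lborel) = (\<integral>\<^sup>+u. ?g u \<partial>lborel)"
    using nn_integral_real_affine[of ?g "- 1" 0] by simp
  have "ennreal ((1 + u\<^sup>2) powr (- 3 / 5)) \<le> ennreal (2 powr (3 / 5)) * (?g u + ?g (- u))" for u :: real
  proof -
    \<comment> \<open>A rearrangement of the nonnegativity of the square of
      \<open>1 - \<bar>u\<bar>\<close>; the denominator 2 produces the constant
      \<open>2 powr (3 / 5)\<close>.\<close>
    have "(1 + \<bar>u\<bar>)\<^sup>2 / 2 \<le> 1 + u\<^sup>2"
      using zero_le_power2[of "1 - \<bar>u\<bar>"] by (simp add: power2_eq_square algebra_simps)
    then have "(1 + u\<^sup>2) powr (- 3 / 5) \<le> ((1 + \<bar>u\<bar>)\<^sup>2 / 2) powr (- 3 / 5)"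
      by (intro powr_mono2') (auto intro: zero_less_power)
    also have "\<dots> = ((1 + \<bar>u\<bar>) powr 2) powr (- 3 / 5) / 2 powr (- 3 / 5)"
      by (subst powr_divide) auto
    also have "\<dots> = 2 powr (3 / 5) * (1 + \<bar>u\<bar>) powr (- 6 / 5)"
      unfolding powr_powr using powr_minus[of 2 "3/5 :: real"] by (simp add: field_simps)
    finally have "ennreal ((1 + u\<^sup>2) powr (- 3 / 5)) \<le>
        ennreal (2 powr (3 / 5)) * ennreal ((1 + \<bar>u\<bar>) powr (- 6 / 5))"
      by (subst ennreal_mult[symmetric]) (auto intro: ennreal_leI)
    also have "\<dots> \<le> ennreal (2 powr (3 / 5)) * (?g u + ?g (- u))"
      by (intro mult_left_mono) (auto split: split_indicator simp: abs_if)
    finally show ?thesis .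
  qed
  then have "(\<integral>\<^sup>+u. ennreal ((1 + u\<^sup>2) powr (- 3 / 5)) \<partial>lborel) \<le>
      (\<integral>\<^sup>+u. ennreal (2 powr (3 / 5)) * (?g u + ?g (- u)) \<partial>lborel)"
    by (intro nn_integral_mono)
  also have "\<dots> = ennreal (2 powr (3 / 5)) * ((\<integral>\<^sup>+u. ?g u \<partial>lborel) + (\<integral>\<^sup>+u. ?g (- u) \<partial>lborel))"
    by (subst nn_integral_cmult, measurable, subst nn_integral_add, measurable)
  also have "\<dots> < \<infinity>"
    unfolding g' using g by (simp add: ennreal_mult_less_top)
  finally show ?thesis .
qed

lemma nn_integral_prod_Basis_powr:
  "(\<integral>\<^sup>+x. ennreal ((\<Prod>b\<in>Basis. 1 + (x \<bullet> b)\<^sup>2) powr (- 3 / 5)) \<partial>(lborel :: 'b::euclidean_space measure)) < \<infinity>"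
proof -
  have "ennreal ((\<Prod>b\<in>Basis. 1 + (x \<bullet> b)\<^sup>2) powr (- 3 / 5)) =
      (\<Prod>b\<in>Basis. ennreal ((1 + (x \<bullet> b)\<^sup>2) powr (- 3 / 5)))" for x :: 'b
    by (simp add: prod_ennreal prod_powr_distrib)
  then have "(\<integral>\<^sup>+x. ennreal ((\<Prod>b\<in>Basis. 1 + (x \<bullet> b)\<^sup>2) powr (- 3 / 5)) \<partial>(lborel :: 'b measure)) =
    (\<Prod>b\<in>(Basis :: 'b set). (\<integral>\<^sup>+u. ennreal ((1 + u\<^sup>2) powr (- 3 / 5)) \<partial>lborel))"
    using nn_integral_lborel_prod[of "\<lambda>(_ :: 'b) u. ennreal ((1 + u\<^sup>2) powr (- 3 / 5))"]
    by (simp only:) simp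
  also have "\<dots> < \<infinity>"
    using nn_integral_one_plus_square_powr by (simp add: power_less_top_ennreal)
  finally show ?thesis .
qed

section \<open>Comparison of the minors with a product over real coordinates\<close>

lemma prod_one_plus_inner_square_le:
  fixes y :: "'a::euclidean_space"
  shows "(\<Prod>b\<in>Basis. 1 + (y \<bullet> b)\<^sup>2) \<le> (1 + (norm y)\<^sup>2) ^ DIM('a)"
proof -
  have "(y \<bullet> b)\<^sup>2 \<le> (norm y)\<^sup>2" if "b \<in> Basis" for b
    using Basis_le_norm[OF that, of y] by (metis abs_ge_zero power2_abs power_mono)
  then have "(\<Prod>b\<in>Basis. 1 + (y \<bullet> b)\<^sup>2) \<le> (\<Prod>b\<in>(Basis :: 'a set). 1 + (norm y)\<^sup>2)"
    by (intro prod_mono) auto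
  then show ?thesis by simp
qed

lemma prod_Basis_prod_eq:
  "(\<Prod>b\<in>(Basis :: ('a::euclidean_space \<times> 'b::euclidean_space) set). f b) =
    (\<Prod>b\<in>Basis. f (b, 0)) * (\<Prod>b\<in>Basis. f (0, b))"
proof -
  have inj: "inj_on (\<lambda>u::'a. (u, 0 :: 'b)) Basis" "inj_on (\<lambda>u::'b. (0 :: 'a, u)) Basis"
    by (auto intro!: inj_onI)
  show ?thesis
    unfolding Basis_prod_def
    by (subst prod.union_disjoint) (auto simp: Basis_prod_def prod.reindex[OF inj(1)] prod.reindex[OF inj(2)])
qed

text \<open>With \<open>u = 1 + \<bar>y\<bar>\<^sup>2\<close> and \<open>v = 1 + \<bar>z\<bar>\<^sup>2\<close> the first minor is at least \<open>v\<close>, and the second one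
  is at least \<open>u\<^sup>2\<close> and at least \<open>v\<close>; the weights are chosen so that \<open>u\<close> and \<open>v\<close> get equal exponents.\<close>

lemma minors_lower_bound:
  fixes s t :: real
  assumes "s \<ge> 0" "t \<ge> 0"
  shows "((1 + s) * (1 + t)) ^ 4 \<le> ((1 + s + t) * ((1 + s)\<^sup>2 + t)) ^ 3"
proof -
  have e1: "(1 + s)\<^sup>2 \<le> (1 + s)\<^sup>2 + t" and e2: "1 + t \<le> (1 + s)\<^sup>2 + t" and d: "1 + t \<le> 1 + s + t"
    using assms by (simp_all add: power2_eq_square algebra_simps)
  have "(1 + t) ^ 3 * (((1 + s)\<^sup>2)\<^sup>2 * (1 + t)) \<le> (1 + s + t) ^ 3 * (((1 + s)\<^sup>2 + t)\<^sup>2 * ((1 + s)\<^sup>2 + t))"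
    using assms by (intro mult_mono power_mono e1 e2 d) auto
  then show ?thesis
    by (simp add: power_mult_distrib algebra_simps power2_eq_square power3_eq_cube power4_eq_xxxx)
qed

definition minors_prod :: "'a::real_normed_vector \<Rightarrow> 'a \<Rightarrow> real" where
  "minors_prod y z = (1 + (norm y)\<^sup>2 + (norm z)\<^sup>2) * ((1 + (norm y)\<^sup>2)\<^sup>2 + (norm z)\<^sup>2)"

lemma minors_prod_ge_1: "minors_prod y z \<ge> 1"
proof -
  have "1 * 1 \<le> minors_prod y z"
    unfolding minors_prod_def
    by (intro mult_mono) (auto intro!: add_increasing2 one_le_power simp: add_nonneg_nonneg)
  then show ?thesis by simp
qed

text \<open>With \<open>P\<close> and \<open>Q\<close> as in the proof,
  \<open>minors_lower_bound\<close> gives \<open>Q ^ 4 \<le> P ^ 6\<close>. Thus the exponent -9/10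
  of \<open>P\<close> becomes -3/5 for \<open>Q\<close>, still below the critical value -1/2 in each
  coordinate.\<close>

lemma minors_prod_powr_le:
  fixes y z :: "'a::euclidean_space"
  shows "(sqrt (minors_prod y z) ^ DIM('a)) powr (- 9 / 10) \<le>
    (\<Prod>b\<in>Basis. 1 + ((y, z) \<bullet> b)\<^sup>2) powr (- 3 / 5)"
proof -
  define P where "P = sqrt (minors_prod y z) ^ DIM('a)"
  define Q where "Q = (\<Prod>b\<in>Basis. 1 + ((y, z) \<bullet> b)\<^sup>2)"
  have "Q > 0"
    unfolding Q_def by (intro prod_pos) (auto intro: add_pos_nonneg)
  have "P > 0"
    using minors_prod_ge_1[of y z] by (simp add: P_def)
  have "Q \<le> (1 + (norm y)\<^sup>2) ^ DIM('a) * (1 + (norm z)\<^sup>2) ^ DIM('a)"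
    unfolding Q_def prod_Basis_prod_eq
    using prod_one_plus_inner_square_le[of y] prod_one_plus_inner_square_le[of z]
    by (simp, intro mult_mono) (auto intro!: prod_nonneg)
  then have "Q ^ 4 \<le> (((1 + (norm y)\<^sup>2) * (1 + (norm z)\<^sup>2)) ^ DIM('a)) ^ 4"
    using \<open>Q > 0\<close> by (intro power_mono) (auto simp: power_mult_distrib)
  also have "\<dots> = (((1 + (norm y)\<^sup>2) * (1 + (norm z)\<^sup>2)) ^ 4) ^ DIM('a)"
    by (simp add: power_mult[symmetric] mult.commute)
  also have "\<dots> \<le> (minors_prod y z ^ 3) ^ DIM('a)"
    unfolding minors_prod_def by (intro power_mono minors_lower_bound) auto
  also have "\<dots> = ((sqrt (minors_prod y z))\<^sup>2 ^ 3) ^ DIM('a)"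
    using minors_prod_ge_1[of y z] by simp
  also have "\<dots> = (P ^ 3)\<^sup>2"
    by (simp add: P_def power_mult[symmetric] mult.commute mult.left_commute)
  finally have "(Q\<^sup>2)\<^sup>2 \<le> (P ^ 3)\<^sup>2"
    by (simp add: power_mult[symmetric])
  then have "Q\<^sup>2 \<le> P ^ 3"
    by (rule power2_le_imp_le) (use \<open>P > 0\<close> in simp)
  then have "(P powr 3) powr (- 3 / 10) \<le> (Q powr 2) powr (- 3 / 10)"
    using \<open>P > 0\<close> \<open>Q > 0\<close> by (intro powr_mono2') auto
  then show ?thesis
    unfolding powr_powr P_def Q_def by simp
qed

subsection \<open>Convergence of the integral\<close>

context iwasawa_involution
begin

lemma rho_power_iwasawa_a:
  fixes \<kappa> :: "'k::finite \<Rightarrow> 'a"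
  assumes "bij_betw \<kappa> UNIV Basis"
  shows "rho_power (iwasawa_a K (commN4_elt y z)) = sqrt (minors_prod y z) ^ DIM('a)"
proof -
  define d where "d = 1 + (norm y)\<^sup>2 + (norm z)\<^sup>2"
  define e where "e = (1 + (norm y)\<^sup>2)\<^sup>2 + (norm z)\<^sup>2"
  have "d > 0" by (simp add: d_def add_pos_nonneg)
  have "e > 0" by (simp add: e_def add_pos_nonneg[OF zero_less_power[OF add_pos_nonneg]])
  have "rho_power (iwasawa_a K (commN4_elt y z)) = ((sqrt d)\<^sup>2 * sqrt (e / d)) ^ DIM('a)"
    unfolding iwasawa_a_commN4_elt d_def[symmetric] e_def[symmetric]
    using \<open>d > 0\<close> \<open>e > 0\<close> by (intro rho_power_diag4[OF assms]) simp_all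
  also have "(sqrt d)\<^sup>2 * sqrt (e / d) = sqrt (d * e)"
    using \<open>d > 0\<close> by (simp add: real_sqrt_mult real_sqrt_divide power2_eq_square real_div_sqrt
        flip: times_divide_eq_left)
  finally show ?thesis
    by (simp add: minors_prod_def d_def e_def)
qed

end

lemma commN4_elt_in_commN4: "commN4_elt (y :: 'a::field_char_0) z \<in> commN4"
  using rangeI[of "\<lambda>(y, z). commN4_elt y z" "(y, z)"] by (simp add: commN4_eq)

lemma continuous_on_commN4_elt:
  fixes f g :: "'b::topological_space \<Rightarrow> 'a::real_normed_field"
  assumes [continuous_intros]: "continuous_on S f" "continuous_on S g"
  shows "continuous_on S (\<lambda>x. commN4_elt (f x) (g x))"
proof -
  have "continuous_on S (\<lambda>x. commN4_elt (f x) (g x) $ i $ j)" for i j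
    using exhaust_4[of i] exhaust_4[of j]
    by (elim disjE) (simp_all add: commN4_elt_def vector_4 assms)
  then have "continuous_on S (\<lambda>x. \<chi> i j. commN4_elt (f x) (g x) $ i $ j)"
    by (intro continuous_on_vec_lambda)
  then show ?thesis
    by simp
qed

text \<open>The group is the set where a matrix agrees with the one rebuilt continuously from its
  entries (1,3) and (1,4). Closedness makes its indicator Borel measurable.\<close>

lemma closed_commN4: "closed (commN4 :: ('a::real_normed_field^4^4) set)"
proof -
  have "g \<in> commN4 \<longleftrightarrow> g = commN4_elt (g$1$3) (g$1$4)" for g :: "'a^4^4"
  proof
    assume "g \<in> commN4"
    then obtain y z where "g = commN4_elt y z"
      unfolding commN4_eq by auto
    then show "g = commN4_elt (g$1$3) (g$1$4)"
      by (simp add: commN4_elt_def vector_4)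
  next
    assume "g = commN4_elt (g$1$3) (g$1$4)"
    then show "g \<in> commN4"
      by (metis commN4_elt_in_commN4)
  qed
  then have "commN4 = {g :: 'a^4^4. g = commN4_elt (g$1$3) (g$1$4)}"
    by blast
  also have "closed \<dots>"
    by (intro closed_Collect_eq continuous_on_commN4_elt continuous_intros)
  finally show ?thesis .
qed

text \<open>The integrand involves \<open>iwasawa_a\<close>, defined by a description, so
  measurability is not addressed directly. On the group it equals an explicit function
  \<open>h\<close> of two matrix entries, and integrability is shown for that function.\<close>

lemma (in iwasawa_involution) set_integrable_rho_power:
  fixes \<kappa> :: "'k::finite \<Rightarrow> 'a"
  assumes \<kappa>: "bij_betw \<kappa> UNIV Basis"
  shows "set_integrable haar_commN4 commN4
    (\<lambda>n. inverse (rho_power (iwasawa_a K n)) * (1 + rho_log (iwasawa_a K n)) powr r)"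
proof -
  define P :: "'a \<Rightarrow> 'a \<Rightarrow> real" where "P y z = sqrt (minors_prod y z) ^ DIM('a)" for y z
  define h where "h y z = inverse (P y z) * (1 + ln (P y z)) powr r" for y z
  have P_ge_1: "P y z \<ge> 1" for y z
    using minors_prod_ge_1[of y z] by (simp add: P_def one_le_power)
  have meas: "(\<lambda>(y, z). commN4_elt y z) \<in> measurable lborel (borel :: ('a^4^4) measure)"
    unfolding split_def measurable_lborel2
    by (intro borel_measurable_continuous_onI continuous_on_commN4_elt continuous_intros)
  have [measurable]: "(\<lambda>n :: 'a^4^4. P (n$1$3) (n$1$4)) \<in> borel_measurable borel"
    unfolding P_def minors_prod_def
    by (intro borel_measurable_continuous_onI continuous_intros)
  have [measurable]: "(\<lambda>x. P (fst x) (snd x)) \<in> borel_measurable borel"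
    unfolding P_def minors_prod_def
    by (intro borel_measurable_continuous_onI continuous_intros)
  have [measurable]: "(commN4 :: ('a^4^4) set) \<in> sets borel"
    by (rule borel_closed[OF closed_commN4])
  \<comment> \<open>Spending the power 1/10 on the logarithm leaves the exponent -9/10 of
    \<open>minors_prod_powr_le\<close>.\<close>
  obtain C where C: "C \<ge> 0" "\<And>P. P \<ge> 1 \<Longrightarrow> (1 + ln P) powr r \<le> C * P powr (1 / 10)"
    using log_powr_bound[of "1 / 10" r] by auto
  have h_bound: "h y z \<le> C * (\<Prod>b\<in>Basis. 1 + ((y, z) \<bullet> b)\<^sup>2) powr (- 3 / 5)" for y z
  proof -
    have "h y z \<le> P y z powr (- 1) * (C * P y z powr (1 / 10))"
      unfolding h_def using C(2)[OF P_ge_1[of y z]] P_ge_1[of y z]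
      by (simp add: powr_minus mult_left_mono)
    also have "\<dots> = C * P y z powr (- 9 / 10)"
      using powr_add[of "P y z" "- 1" "1 / 10"] by simp
    also have "\<dots> \<le> C * (\<Prod>b\<in>Basis. 1 + ((y, z) \<bullet> b)\<^sup>2) powr (- 3 / 5)"
      unfolding P_def using C(1) by (intro mult_left_mono minors_prod_powr_le)
    finally show ?thesis .
  qed
  have h_nonneg: "h y z \<ge> 0" for y z
    using P_ge_1[of y z] by (simp add: h_def)
  have "integrable lborel (\<lambda>x :: 'a \<times> 'a. h (fst x) (snd x))"
  proof (rule integrableI_bounded)
    show "(\<lambda>x. h (fst x) (snd x)) \<in> borel_measurable lborel"
      unfolding h_def by measurable
    have "(\<integral>\<^sup>+x. ennreal (norm (h (fst x) (snd x))) \<partial>(lborel :: ('a \<times> 'a) measure)) \<le>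
      (\<integral>\<^sup>+x. ennreal C * ennreal ((\<Prod>b\<in>Basis. 1 + (x \<bullet> b)\<^sup>2) powr (- 3 / 5))
        \<partial>(lborel :: ('a \<times> 'a) measure))"
    proof (rule nn_integral_mono)
      fix x :: "'a \<times> 'a"
      show "ennreal (norm (h (fst x) (snd x))) \<le>
          ennreal C * ennreal ((\<Prod>b\<in>Basis. 1 + (x \<bullet> b)\<^sup>2) powr (- 3 / 5))"
        using h_nonneg[of "fst x" "snd x"] h_bound[of "fst x" "snd x"] C(1)
        by (simp flip: ennreal_mult)
    qed
    also have "\<dots> < \<infinity>"
      using nn_integral_prod_Basis_powr[where 'b = "'a \<times> 'a"]
      by (subst nn_integral_cmult) (auto simp: ennreal_mult_less_top)
    finally show "(\<integral>\<^sup>+x. ennreal (norm (h (fst x) (snd x))) \<partial>lborel) < \<infinity>" .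
  qed
  moreover have "indicator commN4 (commN4_elt y z) = (1 :: real)" for y z :: 'a
    using commN4_elt_in_commN4[of y z] by simp
  moreover have "commN4_elt y z $ 1 $ 3 = y" "commN4_elt y z $ 1 $ 4 = z" for y z :: 'a
    by (simp_all add: commN4_elt_def vector_4)
  ultimately have "integrable haar_commN4 (\<lambda>n :: 'a^4^4. indicator commN4 n *\<^sub>R h (n$1$3) (n$1$4))"
    unfolding haar_commN4_def h_def
    by (subst integrable_distr_eq[OF meas]) (simp_all add: split_def)
  moreover have "indicator commN4 n *\<^sub>R h (n$1$3) (n$1$4) = indicator commN4 n *\<^sub>R
     (inverse (rho_power (iwasawa_a K n)) * (1 + rho_log (iwasawa_a K n)) powr r)" for n
  proof (cases "n \<in> commN4")
    case True
    then obtain y z where n: "n = commN4_elt y z"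
      unfolding commN4_eq by auto
    have "n$1$3 = y" "n$1$4 = z"
      by (simp_all add: n commN4_elt_def vector_4)
    then show ?thesis
      by (simp add: h_def P_def rho_log_def n rho_power_iwasawa_a[OF \<kappa>])
  qed simp
  ultimately show ?thesis
    unfolding set_integrable_def by (simp only:)
qed

section \<open>The real and the complex group\<close>

lemma matrix_mult_eq_1_iff:
  fixes A B :: "'a::field^'n^'n"
  shows "B ** A = mat 1 \<and> A ** B = mat 1 \<longleftrightarrow> A ** B = mat 1"
  using matrix_left_right_inverse by blast

interpretation real: iwasawa_involution "\<lambda>x. x" K4_real
proof
  show "g \<in> K4_real \<longleftrightarrow> g \<in> Sp4 \<and> g ** (\<chi> i j. g$j$i) = mat 1" for g
    by (simp add: K4_real_def orthogonal_matrix_def matrix_mult_eq_1_iff)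
      (simp add: transpose_def)
qed (simp_all add: power2_eq_square)

interpretation complex: iwasawa_involution cnj K4_complex
proof
  show "g \<in> K4_complex \<longleftrightarrow> g \<in> Sp4 \<and> g ** (\<chi> i j. cnj (g$j$i)) = mat 1" for g
    by (simp add: K4_complex_def unitary_matrix_def matrix_mult_eq_1_iff)
      (simp add: adjoint_matrix_def)
qed (simp_all add: complex_norm_square del: of_real_power)

theorem mainTheorem3:
  fixes r :: real
  shows
    "set_integrable (haar_commN4 :: (real^4^4) measure) commN4
       (\<lambda>n. inverse (rho_power (iwasawa_a K4_real n)) *
            (1 + rho_log (iwasawa_a K4_real n)) powr r)
     \<and>
     set_integrable (haar_commN4 :: (complex^4^4) measure) commN4
       (\<lambda>n. inverse (rho_power (iwasawa_a K4_complex n)) *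
            (1 + rho_log (iwasawa_a K4_complex n)) powr r)"
proof
  have "bij_betw (\<lambda>_ :: unit. 1 :: real) UNIV Basis"
    by (simp add: bij_betw_def inj_on_def)
  then show "set_integrable (haar_commN4 :: (real^4^4) measure) commN4
       (\<lambda>n. inverse (rho_power (iwasawa_a K4_real n)) *
            (1 + rho_log (iwasawa_a K4_real n)) powr r)"
    by (rule real.set_integrable_rho_power)
  \<comment> \<open>The two real directions 1 and \<i> of the complex plane are indexed by the
    booleans.\<close>
  have "bij_betw (\<lambda>b. if b then 1 else \<i>) UNIV Basis"
    by (auto simp: bij_betw_def inj_on_def Basis_complex_def complex_eq_iff UNIV_bool)
  then show "set_integrable (haar_commN4 :: (complex^4^4) measure) commN4
       (\<lambda>n. inverse (rho_power (iwasawa_a K4_complex n)) *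
            (1 + rho_log (iwasawa_a K4_complex n)) powr r)"
    by (rule complex.set_integrable_rho_power)
qed

end
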